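(* If $A,B\in\mathbb{R}_+^{n\times n}$ commute in max algebra, i.e. $AB=BA$, then they have a common eigenvector: there exist a nonzero $v\in\mathbb{R}_+^n$ and $\alpha,\mu\in\mathbb{R}_+$ such that $Av=\alpha v$ and $Bv=\mu v$.
   Context: Max algebra is the semiring $(\mathbb{R}_+,\oplus,\times)$, where $\mathbb{R}_+=[0,\infty)$, $a\oplus b=\max(a,b)$ and $\times$ is ordinary multiplication. All matrix and matrix-vector operations are over this semiring: $(AB)_{ij}=\max_k a_{ik}b_{kj}$ and $(Av)_i=\max_k a_{ik}v_k$. *)

theory Defs
  imports "HOL-Analysis.Finite_Cartesian_Product"
begin

text \<open>
  Matrices and vectors over the max-times semiring of nonnegative reals are represented by
  real matrices and vectors together with the predicates below. The index types are
  finite and nonempty, so the maxima are attained.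
\<close>

definition nonneg_vec :: "real ^ 'n \<Rightarrow> bool"
  where "nonneg_vec v \<longleftrightarrow> (\<forall>i. 0 \<le> v $ i)"

definition nonneg_mat :: "real ^ 'n ^ 'm \<Rightarrow> bool"
  where "nonneg_mat A \<longleftrightarrow> (\<forall>i j. 0 \<le> A $ i $ j)"

definition max_matrix_mult :: "real ^ 'n ^ 'm \<Rightarrow> real ^ 'p ^ 'n \<Rightarrow> real ^ 'p ^ 'm"
    (infixl "\<otimes>\<^sub>m" 70)
  where "A \<otimes>\<^sub>m B = (\<chi> i j. Max (range (\<lambda>k. A $ i $ k * B $ k $ j)))"

definition max_matrix_vec :: "real ^ 'n ^ 'm \<Rightarrow> real ^ 'n \<Rightarrow> real ^ 'm"
    (infixl "\<otimes>\<^sub>v" 70)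
  where "A \<otimes>\<^sub>v v = (\<chi> i. Max (range (\<lambda>k. A $ i $ k * v $ k)))"

end

theory Submission
  imports Defs "HOL-Analysis.Cartesian_Euclidean_Space" "HOL-Analysis.Ordered_Euclidean_Space"
begin

text \<open>
  Write \<open>\<oplus>\<close> for the componentwise maximum. If \<open>A\<close> has an eigenvector \<open>a\<close> with eigenvalue \<open>\<alpha>\<close>, the
  nonnegative solutions of \<open>A v = \<alpha> v\<close> form a closed cone \<open>K\<close> that contains \<open>\<oplus>\<close> of any two of its
  elements, and \<open>B\<close> maps \<open>K\<close> into itself because \<open>A (B v) = B (A v) = \<alpha> (B v)\<close>. So everything
  follows from one result (\<open>exists_eigenvector\<close>): a max-linear continuous map \<open>T\<close> of a nonzero closed
  max-cone \<open>K\<close> into itself has an eigenvector in \<open>K\<close>. It is used twice, first for \<open>A\<close> on the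
  whole nonnegative orthant, then for \<open>B\<close> on the eigencone of \<open>A\<close>.

  To find an eigenvector of \<open>T\<close>, consider the nonzero \<open>y\<close> in \<open>K\<close> with \<open>T y \<le> C y\<close> for some
  \<open>C\<close>. Minimizing the support among them gives a \<open>y\<close> in \<open>K\<close> such that either \<open>T y = 0\<close>, and
  \<open>y\<close> is an eigenvector for \<open>0\<close>, or \<open>c y \<le> T y \<le> C y\<close> with \<open>c > 0\<close>
  (\<open>exists_zero_or_stable_supp\<close>). In the second case let \<open>r\<close> be
  the infimum of the set \<open>P\<close> of all \<open>\<lambda> > 0\<close> for which some \<open>u\<close> in \<open>K\<close> has \<open>y \<le> u\<close> and
  \<open>T u \<le> \<lambda> u\<close>; the bounds on \<open>T y\<close> give \<open>c \<le> r \<le> C\<close>. For \<open>\<lambda>\<close> in \<open>P\<close> the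
  resolvent equation \<open>\<lambda> s = \<lambda> y \<oplus> T s\<close> has a solution in \<open>K\<close>, obtained by monotone iteration from
  \<open>y\<close> upwards, below \<open>u\<close> (\<open>exists_resolvent\<close>). Dividing by \<open>norm s\<close> and letting \<open>\<lambda>\<close> tend to \<open>r\<close>,
  compactness yields a unit vector \<open>v\<close> in \<open>K\<close> with \<open>r v = r t y \<oplus> T v\<close>, where \<open>t \<ge> 0\<close> is a limit of
  the factors \<open>1 / norm s\<close> (\<open>exists_limit_resolvent\<close>).

  If \<open>t = 0\<close>, then \<open>v\<close> is an eigenvector. If \<open>t > 0\<close>, then \<open>T v \<le> r v\<close>, so the iterates of
  \<open>T / r\<close> on \<open>v\<close> decrease to a solution \<open>w\<close> of \<open>T w = r w\<close>. It is nonzero by the choice of \<open>r\<close>: if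
  \<open>w = 0\<close>, some iterate is at most \<open>v / 2\<close>, and a weighted maximum of the iterates shows that a number
  smaller than \<open>r\<close> is in \<open>P\<close>, since \<open>v\<close> dominates a multiple of \<open>y\<close>
  (\<open>eigenvector_of_critical_subeigenvector\<close>).
\<close>

section \<open>Order and convergence in Euclidean space\<close>

text \<open>
  Type \<open>real\<close> is itself an ordered Euclidean space, so rewriting with \<open>eucl_le\<close> at every type does
  not terminate: it applies again to the inequalities between coordinates that it produces.
  Hence its type is always instantiated.
\<close>

lemma tendsto_le_eucl:
  fixes X Y :: "nat \<Rightarrow> 'a::ordered_euclidean_space"
  assumes "X \<longlonglongrightarrow> x" "Y \<longlonglongrightarrow> y" "\<And>n. X n \<le> Y n"
  shows "x \<le> y"
  unfolding eucl_le[where 'a='a]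
proof
  fix i :: 'a assume i: "i \<in> Basis"
  show "x \<bullet> i \<le> y \<bullet> i"
    by (rule LIMSEQ_le[OF tendsto_inner[OF assms(1) tendsto_const]
        tendsto_inner[OF assms(2) tendsto_const]])
       (use assms(3) i in \<open>auto simp: eucl_le[where 'a='a]\<close>)
qed

lemma scaleR_sup:
  fixes x y :: "'a::ordered_euclidean_space"
  assumes "0 \<le> c"
  shows "c *\<^sub>R sup x y = sup (c *\<^sub>R x) (c *\<^sub>R y)"
  by (rule euclidean_eqI)
     (use assms in \<open>simp add: inner_Basis_sup_left sup_real_def max_mult_distrib_left\<close>)

lemma monotone_bounded_convergent_eucl:
  fixes X :: "nat \<Rightarrow> 'a::ordered_euclidean_space"
  assumes mono: "incseq X \<or> decseq X" and bounds: "\<And>n. a \<le> X n" "\<And>n. X n \<le> b"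
  shows "convergent X"
proof -
  have "convergent (\<lambda>n. X n \<bullet> i)" if i: "i \<in> Basis" for i
  proof (rule Bseq_monoseq_convergent)
    show "Bseq (\<lambda>n. X n \<bullet> i)"
    proof (rule BseqI')
      fix n
      show "norm (X n \<bullet> i) \<le> max \<bar>a \<bullet> i\<bar> \<bar>b \<bullet> i\<bar>"
        using bounds(1)[of n] bounds(2)[of n] i unfolding eucl_le[where 'a='a] by fastforce
    qed
    show "monoseq (\<lambda>n. X n \<bullet> i)"
      using mono
    proof
      assume "incseq X"
      then show ?thesis
        using i by (auto simp: eucl_le[where 'a='a] dest: incseqD intro!: monoI1)
    next
      assume "decseq X"
      then have "X n \<le> X m" if "m \<le> n" for m n
        using that by (rule decseqD)
      then show ?thesis
        using i by (auto simp: eucl_le[where 'a='a] intro!: monoI2)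
    qed
  qed
  then obtain L where L: "(\<lambda>n. X n \<bullet> i) \<longlonglongrightarrow> L i" if "i \<in> Basis" for i
    unfolding convergent_def by metis
  have "X \<longlonglongrightarrow> (\<Sum>i\<in>Basis. L i *\<^sub>R i)"
    unfolding tendsto_componentwise_iff[of X] using L by (auto simp: inner_sum_left_Basis)
  then show ?thesis
    by (rule convergentI)
qed

text \<open>
  In the nonnegative orthant, inclusion of supports is domination up to a positive factor
  (\<open>supp_subset_imp_le_scaleR\<close> below). Being a finite set, a support is what extremal choices
  can be made on.
\<close>

definition supp :: "'a::euclidean_space \<Rightarrow> 'a set"
  where "supp x = {i \<in> Basis. x \<bullet> i \<noteq> 0}"

lemma finite_supp: "finite (supp x)"
  by (simp add: supp_def)

lemma supp_eq_empty_iff: "supp x = {} \<longleftrightarrow> x = 0"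
  by (auto simp: supp_def euclidean_eq_iff[of x 0])

lemma supp_mono:
  fixes x y :: "'a::ordered_euclidean_space"
  assumes "0 \<le> x" "x \<le> y"
  shows "supp x \<subseteq> supp y"
  using assms unfolding supp_def eucl_le[where 'a='a] by force

lemma supp_scaleR_subset: "supp (c *\<^sub>R x) \<subseteq> supp x"
  by (auto simp: supp_def)

lemma supp_subset_imp_le_scaleR:
  fixes x y :: "'a::ordered_euclidean_space"
  assumes "0 \<le> x" "0 \<le> y" "supp x \<subseteq> supp y"
  obtains c where "c > 0" "x \<le> c *\<^sub>R y"
proof
  let ?c = "1 + (\<Sum>i\<in>Basis. (x \<bullet> i) / (y \<bullet> i))"
  have nn: "0 \<le> (x \<bullet> i) / (y \<bullet> i)" if "i \<in> Basis" for i
    using assms(1,2) that by (auto simp: eucl_le[where 'a='a])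
  show "?c > 0"
    using sum_nonneg[OF nn, of Basis "\<lambda>i. i"] by (simp add: add_pos_nonneg)
  show "x \<le> ?c *\<^sub>R y"
    unfolding eucl_le[where 'a='a]
  proof
    fix i :: 'a assume i: "i \<in> Basis"
    show "x \<bullet> i \<le> (?c *\<^sub>R y) \<bullet> i"
    proof (cases "y \<bullet> i = 0")
      case True
      then have "x \<bullet> i = 0"
        using assms(3) i by (auto simp: supp_def)
      then show ?thesis using True by simp
    next
      case False
      then have y: "y \<bullet> i > 0"
        using assms(2) i by (auto simp: eucl_le[where 'a='a] less_le)
      have "(x \<bullet> i) / (y \<bullet> i) \<le> (\<Sum>i\<in>Basis. (x \<bullet> i) / (y \<bullet> i))"
        by (rule member_le_sum) (use i nn in auto)
      then have "(x \<bullet> i) / (y \<bullet> i) \<le> ?c" by linarith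
      then show ?thesis using y unfolding inner_scaleR_left by (simp only: pos_divide_le_eq)
    qed
  qed
qed

section \<open>Eigenvectors of max-linear maps on closed max-cones\<close>

locale max_cone_map =
  fixes K :: "'a::ordered_euclidean_space set" and T :: "'a \<Rightarrow> 'a"
  assumes closed_K: "closed K"
    and nonneg: "x \<in> K \<Longrightarrow> 0 \<le> x"
    and scale_mem: "x \<in> K \<Longrightarrow> 0 \<le> c \<Longrightarrow> c *\<^sub>R x \<in> K"
    and sup_mem: "x \<in> K \<Longrightarrow> y \<in> K \<Longrightarrow> sup x y \<in> K"
    and T_mem: "x \<in> K \<Longrightarrow> T x \<in> K"
    and T_sup: "x \<in> K \<Longrightarrow> y \<in> K \<Longrightarrow> T (sup x y) = sup (T x) (T y)"
    and T_scale: "x \<in> K \<Longrightarrow> 0 \<le> c \<Longrightarrow> T (c *\<^sub>R x) = c *\<^sub>R T x"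
    and T_cont: "continuous_on K T"
begin

lemma T_mono:
  assumes "x \<in> K" "y \<in> K" "x \<le> y"
  shows "T x \<le> T y"
  using T_sup[OF assms(1,2)] assms(3) by (metis sup.absorb2 sup.cobounded1)

lemma T_tendsto:
  assumes "\<And>n. X n \<in> K" "X \<longlonglongrightarrow> x"
  shows "x \<in> K" "(\<lambda>n. T (X n)) \<longlonglongrightarrow> T x"
proof -
  show x: "x \<in> K"
    using closed_sequentially[OF closed_K] assms by blast
  show "(\<lambda>n. T (X n)) \<longlonglongrightarrow> T x"
    by (rule continuous_on_tendsto_compose[OF T_cont assms(2) x]) (use assms(1) in simp)
qed

lemma supp_T_mono:
  assumes "x \<in> K" "y \<in> K" "supp x \<subseteq> supp y"
  shows "supp (T x) \<subseteq> supp (T y)"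
proof -
  obtain c where c: "c > 0" "x \<le> c *\<^sub>R y"
    using supp_subset_imp_le_scaleR nonneg assms by metis
  then have "T x \<le> c *\<^sub>R T y"
    using T_mono[of x "c *\<^sub>R y"] T_scale[of y c] scale_mem[of y c] assms by simp
  then have "supp (T x) \<subseteq> supp (c *\<^sub>R T y)"
    by (intro supp_mono nonneg T_mem assms)
  then show ?thesis
    using supp_scaleR_subset by blast
qed

text \<open>
  \<open>K\<close> has an element \<open>x\<close> whose support contains all others, since \<open>sup\<close> unites supports.
  So the nonzero \<open>y\<close> with \<open>supp (T y) \<subseteq> supp y\<close> include \<open>x\<close>, and \<open>T\<close> preserves this condition
  unless it produces \<open>0\<close>; for one of minimal support the inclusion must be an equality.
\<close>

lemma exists_zero_or_stable_supp:
  assumes "x0 \<in> K" "x0 \<noteq> 0"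
  obtains y where "y \<in> K" "y \<noteq> 0" "T y = 0 \<or> supp (T y) = supp y"
proof -
  have "\<forall>x. x \<in> K \<and> x \<noteq> 0 \<longrightarrow> card (supp x) < Suc (card (Basis :: 'a set))"
    by (auto simp: supp_def less_Suc_eq_le intro!: card_mono)
  then obtain x where x: "x \<in> K" "x \<noteq> 0"
    and x_max: "\<And>z. z \<in> K \<Longrightarrow> z \<noteq> 0 \<Longrightarrow> card (supp z) \<le> card (supp x)"
    using ex_has_greatest_nat[of "\<lambda>x. x \<in> K \<and> x \<noteq> 0" x0 "\<lambda>x. card (supp x)"] assms by metis
  have x_dom: "supp z \<subseteq> supp x" if z: "z \<in> K" for z
  proof -
    have m: "sup x z \<in> K" using x z sup_mem by blast
    have sub: "supp x \<subseteq> supp (sup x z)" "supp z \<subseteq> supp (sup x z)"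
      by (intro supp_mono nonneg x z sup_ge1 sup_ge2)+
    moreover have "sup x z \<noteq> 0"
      using sub x(2) supp_eq_empty_iff by blast
    ultimately have "supp x = supp (sup x z)"
      using x_max[OF m] by (intro card_seteq finite_supp)
    with sub show ?thesis by simp
  qed
  let ?Q = "\<lambda>y. y \<in> K \<and> y \<noteq> 0 \<and> supp (T y) \<subseteq> supp y"
  have "?Q x" using x x_dom T_mem by auto
  then obtain y where y: "?Q y" and y_min: "\<And>z. ?Q z \<Longrightarrow> card (supp y) \<le> card (supp z)"
    using ex_has_least_nat[of ?Q x "\<lambda>y. card (supp y)"] by metis
  have "supp (T y) = supp y" if "T y \<noteq> 0"
  proof -
    have "?Q (T y)" using y that T_mem supp_T_mono by blast
    then show ?thesis
      using y y_min by (intro card_seteq finite_supp) auto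
  qed
  then show thesis using y that by blast
qed

text \<open>
  The map \<open>s \<mapsto> sup y (T s / l)\<close> is monotone, moves \<open>y\<close> up and moves \<open>u\<close> down. Its iterates on
  \<open>y\<close> therefore increase and stay below \<open>u\<close>, and their limit is a fixed point by continuity.
\<close>

lemma exists_resolvent:
  assumes y: "y \<in> K" and u: "u \<in> K" "y \<le> u" "T u \<le> l *\<^sub>R u" and l: "0 < l"
  obtains s where "s \<in> K" "y \<le> s" "l *\<^sub>R s = sup (l *\<^sub>R y) (T s)"
proof -
  let ?F = "\<lambda>s. sup y ((1 / l) *\<^sub>R T s)"
  define s where "s n = (?F ^^ n) y" for n
  have s_Suc: "s (Suc n) = ?F (s n)" and s_0: "s 0 = y" for n
    by (simp_all add: s_def)
  have F_mem: "?F x \<in> K" if "x \<in> K" for x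
    using that y l by (intro sup_mem scale_mem T_mem) auto
  have F_mono: "?F x \<le> ?F x'" if "x \<in> K" "x' \<in> K" "x \<le> x'" for x x'
    using T_mono[OF that] l by (intro sup_mono scaleR_left_mono) auto
  have mem: "s n \<in> K" for n
    by (induction n) (use y F_mem in \<open>auto simp: s_0 s_Suc\<close>)
  have inc: "s n \<le> s (Suc n)" for n
  proof (induction n)
    case (Suc n)
    then show ?case using F_mono mem by (metis s_Suc)
  qed (simp add: s_0 s_Suc)
  have "(1 / l) *\<^sub>R T u \<le> (1 / l) *\<^sub>R (l *\<^sub>R u)"
    using u(3) l by (intro scaleR_left_mono) auto
  then have Fu: "?F u \<le> u" using u(2) l by simp
  have le_u: "s n \<le> u" for n
  proof (induction n)
    case (Suc n)
    then show ?case using order_trans[OF F_mono[OF mem u(1) Suc] Fu] by (simp only: s_Suc)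
  qed (simp add: s_0 u(2))
  have "convergent s"
    by (rule monotone_bounded_convergent_eucl[where a = 0 and b = u])
       (use inc nonneg mem le_u in \<open>auto intro: incseq_SucI\<close>)
  then obtain L where L: "s \<longlonglongrightarrow> L" by (auto simp: convergent_def)
  note TL = T_tendsto[OF mem L]
  have "(\<lambda>n. s (Suc n)) \<longlonglongrightarrow> ?F L"
    unfolding s_Suc by (intro tendsto_intros TL)
  then have eq: "L = ?F L"
    using LIMSEQ_unique LIMSEQ_Suc[OF L] by blast
  have "l *\<^sub>R L = sup (l *\<^sub>R y) (T L)"
  proof -
    have "l *\<^sub>R L = l *\<^sub>R ?F L" using eq by simp
    then show ?thesis using l by (simp add: scaleR_sup)
  qed
  moreover have "y \<le> L" using eq sup_ge1 by metis
  ultimately show thesis using that TL by blast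
qed

text \<open>
  The resolvents \<open>s n\<close> may be unbounded as \<open>l n\<close> approaches \<open>r\<close>. Taking a limit of the pairs
  (\<open>s n / norm (s n)\<close>, \<open>1 / norm (s n)\<close>), which range over a compact set because \<open>y \<le> s n\<close>, treats
  blow-up (\<open>t = 0\<close>) and boundedness (\<open>t > 0\<close>) together.
\<close>

lemma exists_limit_resolvent:
  assumes y: "y \<in> K" "y \<noteq> 0"
    and u: "\<And>n. u n \<in> K" "\<And>n. y \<le> u n" "\<And>n. T (u n) \<le> l n *\<^sub>R u n"
    and l: "\<And>n. 0 < l n" "l \<longlonglongrightarrow> r"
  obtains v t where "v \<in> K" "v \<noteq> 0" "0 \<le> t" "t *\<^sub>R y \<le> v"
    "r *\<^sub>R v = sup ((r * t) *\<^sub>R y) (T v)"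
proof -
  have "\<exists>s. s \<in> K \<and> y \<le> s \<and> l n *\<^sub>R s = sup (l n *\<^sub>R y) (T s)" for n
    by (rule exists_resolvent[OF y(1) u(1) u(2) u(3) l(1)]) blast
  then obtain s where s: "\<And>n. s n \<in> K" "\<And>n. y \<le> s n"
    "\<And>n. l n *\<^sub>R s n = sup (l n *\<^sub>R y) (T (s n))" by metis
  define t where "t n = 1 / norm (s n)" for n
  define v where "v n = t n *\<^sub>R s n" for n
  have norm_le: "norm y \<le> norm (s n)" for n
  proof (rule norm_le_componentwise)
    fix i :: 'a assume "i \<in> Basis"
    then show "\<bar>y \<bullet> i\<bar> \<le> \<bar>s n \<bullet> i\<bar>"
      using nonneg[OF y(1)] s(2)[of n] unfolding eucl_le[where 'a='a] by fastforce
  qed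
  have pos: "0 < norm (s n)" for n
    using norm_le[of n] y(2) by (meson less_le_trans zero_less_norm_iff)
  have t: "0 \<le> t n" "t n \<le> 1 / norm y" for n
    using norm_le[of n] y(2) by (auto simp: t_def intro!: frac_le)
  have norm_v: "norm (v n) = 1" for n
    using pos[of n] by (simp add: v_def t_def)
  have v_mem: "v n \<in> K" for n
    using s t scale_mem by (simp add: v_def)
  have v_eq: "l n *\<^sub>R v n = sup ((l n * t n) *\<^sub>R y) (T (v n))" for n
  proof -
    have "l n *\<^sub>R v n = t n *\<^sub>R (l n *\<^sub>R s n)" by (simp add: v_def)
    also have "\<dots> = sup (t n *\<^sub>R l n *\<^sub>R y) (t n *\<^sub>R T (s n))"
      using t(1) by (simp only: s(3) scaleR_sup)
    finally show ?thesis using T_scale[OF s(1) t(1)] by (simp add: v_def mult.commute)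
  qed
  have v_ge: "t n *\<^sub>R y \<le> v n" for n
    using s(2) t(1) by (auto simp: v_def intro: scaleR_left_mono)
  have "compact (sphere (0::'a) 1 \<times> {0..1 / norm y})"
    by (intro compact_Times) auto
  moreover have "(v n, t n) \<in> sphere (0::'a) 1 \<times> {0..1 / norm y}" for n
    using norm_v t by auto
  ultimately obtain p \<phi> where p: "p \<in> sphere (0::'a) 1 \<times> {0..1 / norm y}"
    and \<phi>: "strict_mono \<phi>" and lim: "((\<lambda>n. (v n, t n)) \<circ> \<phi>) \<longlonglongrightarrow> p"
    using seq_compactE[OF compact_imp_seq_compact, of _ "\<lambda>n. (v n, t n)"] by blast
  obtain w \<tau> where p_eq: "p = (w, \<tau>)" by force
  have w: "(\<lambda>n. v (\<phi> n)) \<longlonglongrightarrow> w" and \<tau>: "(\<lambda>n. t (\<phi> n)) \<longlonglongrightarrow> \<tau>"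
    using tendsto_fst[OF lim] tendsto_snd[OF lim] by (simp_all add: p_eq o_def)
  have l': "(\<lambda>n. l (\<phi> n)) \<longlonglongrightarrow> r"
    using LIMSEQ_subseq_LIMSEQ[OF l(2) \<phi>] by (simp add: o_def)
  note Tw = T_tendsto[of "\<lambda>n. v (\<phi> n)", OF v_mem w]
  have "(\<lambda>n. l (\<phi> n) *\<^sub>R v (\<phi> n)) \<longlonglongrightarrow> r *\<^sub>R w"
    by (intro tendsto_intros l' w)
  moreover have "(\<lambda>n. l (\<phi> n) *\<^sub>R v (\<phi> n)) \<longlonglongrightarrow> sup ((r * \<tau>) *\<^sub>R y) (T w)"
    unfolding v_eq by (intro tendsto_intros l' \<tau> Tw)
  ultimately have "r *\<^sub>R w = sup ((r * \<tau>) *\<^sub>R y) (T w)"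
    by (rule LIMSEQ_unique)
  moreover have "\<tau> *\<^sub>R y \<le> w"
    using tendsto_scaleR[OF \<tau> tendsto_const] w v_ge by (rule tendsto_le_eucl)
  ultimately show thesis
    using that[of w \<tau>] Tw(1) p p_eq by force
qed

text \<open>
  Let \<open>x k\<close> be the iterates of \<open>T / r\<close> on \<open>v\<close>, and let \<open>z m\<close> be the maximum of \<open>\<theta> ^ k x k\<close> over
  \<open>k \<le> m\<close>. Applying \<open>\<theta> T / r\<close> shifts the index by one, which adds only the term
  \<open>\<theta> ^ (m + 1) x (m + 1)\<close>. By hypothesis this is at most \<open>v\<close> when \<open>\<theta> ^ (m + 1) = 2\<close>, so
  it is absorbed, and \<open>T (z m) \<le> (r / \<theta>) z m\<close> with \<open>\<theta> > 1\<close>. The shift uses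
  max-linearity of \<open>T\<close>: monotonicity alone does not bound \<open>T\<close> of a maximum from above.
\<close>

lemma subeigenvector_below:
  assumes v: "v \<in> K" and r: "0 < r" and m: "(((\<lambda>x. (1 / r) *\<^sub>R T x) ^^ Suc m) v) \<le> (1 / 2) *\<^sub>R v"
  obtains z \<mu> where "z \<in> K" "v \<le> z" "0 < \<mu>" "\<mu> < r" "T z \<le> \<mu> *\<^sub>R z"
proof -
  define x where "x k = ((\<lambda>x. (1 / r) *\<^sub>R T x) ^^ k) v" for k
  have x_0: "x 0 = v" and x_Suc: "x (Suc k) = (1 / r) *\<^sub>R T (x k)" for k
    by (simp_all add: x_def)
  have x_mem: "x k \<in> K" for k
    by (induction k) (use v r in \<open>auto simp: x_0 x_Suc intro!: scale_mem T_mem\<close>)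
  define \<theta> where "\<theta> = root (Suc m) 2"
  have \<theta>: "1 < \<theta>" "\<theta> ^ Suc m = 2"
    by (simp_all add: \<theta>_def del: power_Suc)
  define z where "z = rec_nat v (\<lambda>k z. sup z (\<theta> ^ Suc k *\<^sub>R x (Suc k)))"
  have z_0: "z 0 = v" and z_Suc: "z (Suc k) = sup (z k) (\<theta> ^ Suc k *\<^sub>R x (Suc k))" for k
    by (simp_all add: z_def)
  have z_mem: "z k \<in> K" for k
  proof (induction k)
    case (Suc k)
    then show ?case unfolding z_Suc using \<theta>(1) x_mem by (intro sup_mem scale_mem) auto
  qed (simp add: z_0 v)
  have v_le: "v \<le> z k" for k
    by (induction k) (auto simp: z_0 z_Suc intro: le_supI1)
  have step: "(\<theta> / r) *\<^sub>R T (z k) \<le> z (Suc k)" for k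
  proof (induction k)
    case 0
    then show ?case by (simp add: z_0 z_Suc x_0 x_Suc)
  next
    case (Suc k)
    have "T (z (Suc k)) = sup (T (z k)) (\<theta> ^ Suc k *\<^sub>R T (x (Suc k)))"
      unfolding z_Suc[of k] using \<theta>(1)
      by (subst T_sup) (auto intro!: z_mem scale_mem x_mem simp: T_scale x_mem simp del: power_Suc)
    then have "(\<theta> / r) *\<^sub>R T (z (Suc k)) =
        sup ((\<theta> / r) *\<^sub>R T (z k)) ((\<theta> / r) *\<^sub>R \<theta> ^ Suc k *\<^sub>R T (x (Suc k)))"
      using \<theta>(1) r by (simp add: scaleR_sup)
    also have "(\<theta> / r) *\<^sub>R \<theta> ^ Suc k *\<^sub>R T (x (Suc k)) = \<theta> ^ Suc (Suc k) *\<^sub>R x (Suc (Suc k))"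
      unfolding x_Suc[of "Suc k"] by (simp add: field_simps)
    also have "sup ((\<theta> / r) *\<^sub>R T (z k)) \<dots> \<le> z (Suc (Suc k))"
      unfolding z_Suc[of "Suc k"] using Suc by (rule sup_mono) simp
    finally show ?case .
  qed
  \<comment> \<open>The new term is already dominated, so the weighted maximum has become stationary.\<close>
  have "\<theta> ^ Suc m *\<^sub>R x (Suc m) \<le> \<theta> ^ Suc m *\<^sub>R (1 / 2) *\<^sub>R v"
    using m \<theta>(1) unfolding x_def by (intro scaleR_left_mono) auto
  also have "\<dots> = v" using \<theta>(2) by simp
  also have "\<dots> \<le> z m" by (rule v_le)
  finally have "z (Suc m) = z m"
    unfolding z_Suc by (rule sup.absorb1)
  with step[of m] have "(\<theta> / r) *\<^sub>R T (z m) \<le> z m" by simp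
  then have "(r / \<theta>) *\<^sub>R (\<theta> / r) *\<^sub>R T (z m) \<le> (r / \<theta>) *\<^sub>R z m"
    using \<theta>(1) r by (intro scaleR_left_mono) auto
  then have "T (z m) \<le> (r / \<theta>) *\<^sub>R z m"
    using \<theta>(1) r by simp
  moreover have "0 < r / \<theta>" "r / \<theta> < r"
    using \<theta>(1) r by (auto simp: field_simps)
  ultimately show thesis using that z_mem v_le by blast
qed

text \<open>
  The iterates of \<open>T / r\<close> on \<open>v\<close> decrease, so they converge to a solution of \<open>T w = r w\<close>. Were it
  \<open>0\<close>, some iterate would be at most \<open>v / 2\<close>, and the previous lemma would contradict the
  minimality of \<open>r\<close>.
\<close>

lemma eigenvector_of_critical_subeigenvector:
  assumes v: "v \<in> K" and r: "0 < r" and sub: "T v \<le> r *\<^sub>R v"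
    and crit: "\<And>z \<mu>. z \<in> K \<Longrightarrow> v \<le> z \<Longrightarrow> 0 < \<mu> \<Longrightarrow> T z \<le> \<mu> *\<^sub>R z \<Longrightarrow> r \<le> \<mu>"
  obtains w where "w \<in> K" "w \<noteq> 0" "T w = r *\<^sub>R w"
proof -
  define x where "x k = ((\<lambda>x. (1 / r) *\<^sub>R T x) ^^ k) v" for k
  have x_0: "x 0 = v" and x_Suc: "x (Suc k) = (1 / r) *\<^sub>R T (x k)" for k
    by (simp_all add: x_def)
  have x_mem: "x k \<in> K" for k
    by (induction k) (use v r in \<open>auto simp: x_0 x_Suc intro!: scale_mem T_mem\<close>)
  have dec: "x (Suc k) \<le> x k" for k
  proof (induction k)
    case 0
    have "(1 / r) *\<^sub>R T v \<le> (1 / r) *\<^sub>R r *\<^sub>R v"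
      using sub r by (intro scaleR_left_mono) auto
    then show ?case using r by (simp add: x_0 x_Suc)
  next
    case (Suc k)
    then show ?case
      unfolding x_Suc[of "Suc k"] x_Suc[of k]
      using r T_mono[OF x_mem x_mem Suc] by (intro scaleR_left_mono) (auto simp: x_Suc)
  qed
  then have decx: "decseq x" by (rule decseq_SucI)
  have le_v: "x k \<le> v" for k
    using decseqD[OF decx, of 0 k] by (simp add: x_0)
  have "convergent x"
    by (rule monotone_bounded_convergent_eucl[where a = 0 and b = v])
       (use decx le_v nonneg x_mem in auto)
  then obtain w where w: "x \<longlonglongrightarrow> w" by (auto simp: convergent_def)
  note Tw = T_tendsto[OF x_mem w]
  have "(\<lambda>k. x (Suc k)) \<longlonglongrightarrow> (1 / r) *\<^sub>R T w"
    unfolding x_Suc by (intro tendsto_intros Tw)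
  then have "w = (1 / r) *\<^sub>R T w"
    using LIMSEQ_unique LIMSEQ_Suc[OF w] by blast
  then have "r *\<^sub>R w = r *\<^sub>R (1 / r) *\<^sub>R T w"
    by simp
  then have eig: "T w = r *\<^sub>R w" using r by simp
  have "w \<noteq> 0"
  proof
    assume w0: "w = 0"
    have "eventually (\<lambda>k. x k \<bullet> i \<le> (1 / 2) * (v \<bullet> i)) sequentially" if i: "i \<in> Basis" for i
    proof (cases "v \<bullet> i = 0")
      case True
      moreover have "x k \<bullet> i \<le> v \<bullet> i" for k
        using le_v[of k] i by (simp add: eucl_le[where 'a='a])
      ultimately show ?thesis by simp
    next
      case False
      then have "0 < (1 / 2) * (v \<bullet> i)"
        using nonneg[OF v] i by (auto simp: eucl_le[where 'a='a] less_le)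
      moreover have "(\<lambda>k. x k \<bullet> i) \<longlonglongrightarrow> 0"
        using tendsto_inner[OF w tendsto_const[of i]] w0 by simp
      ultimately have "eventually (\<lambda>k. x k \<bullet> i < (1 / 2) * (v \<bullet> i)) sequentially"
        by (rule order_tendstoD(2)[rotated])
      then show ?thesis by (rule eventually_mono) simp
    qed
    then have "eventually (\<lambda>k. \<forall>i\<in>Basis. x k \<bullet> i \<le> (1 / 2) * (v \<bullet> i)) sequentially"
      by (simp add: eventually_ball_finite)
    then obtain N where "\<And>k. k \<ge> N \<Longrightarrow> \<forall>i\<in>Basis. x k \<bullet> i \<le> (1 / 2) * (v \<bullet> i)"
      unfolding eventually_sequentially by blast
    then have "x (Suc N) \<le> (1 / 2) *\<^sub>R v"
      by (simp add: eucl_le[where 'a='a])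
    then obtain z \<mu> where "z \<in> K" "v \<le> z" "0 < \<mu>" "\<mu> < r" "T z \<le> \<mu> *\<^sub>R z"
      using subeigenvector_below[OF v r] unfolding x_def by blast
    then show False using crit by force
  qed
  then show thesis using that Tw eig by blast
qed

text \<open>
  An inequality \<open>y \<le> b u\<close> improves itself to \<open>y \<le> T y / c \<le> b T u / c \<le> b (l / c) u\<close>. If
  \<open>l < c\<close>, repetition would force \<open>y \<le> 0\<close>.
\<close>

lemma lower_bound_subeigenvalue:
  assumes y: "y \<in> K" "y \<noteq> 0" "c *\<^sub>R y \<le> T y" and c: "0 < c"
    and u: "u \<in> K" "y \<le> u" "T u \<le> l *\<^sub>R u" and l: "0 < l"
  shows "c \<le> l"
proof (rule ccontr)
  assume "\<not> c \<le> l"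
  then have q: "0 \<le> l / c" "l / c < 1" using c l by auto
  have bound: "y \<le> (l / c) ^ k *\<^sub>R u" for k
  proof (induction k)
    case (Suc k)
    have "c *\<^sub>R y \<le> T y" by (rule y)
    also have "\<dots> \<le> T ((l / c) ^ k *\<^sub>R u)"
      using Suc q y u by (intro T_mono scale_mem) auto
    also have "\<dots> = (l / c) ^ k *\<^sub>R T u"
      using q u by (simp add: T_scale)
    also have "\<dots> \<le> (l / c) ^ k *\<^sub>R l *\<^sub>R u"
      using q u by (intro scaleR_left_mono) auto
    finally have "(1 / c) *\<^sub>R c *\<^sub>R y \<le> (1 / c) *\<^sub>R (l / c) ^ k *\<^sub>R l *\<^sub>R u"
      using c by (intro scaleR_left_mono) auto
    then show ?case using c by (simp add: field_simps)
  qed (simp add: u)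
  have "(\<lambda>k. (l / c) ^ k *\<^sub>R u) \<longlonglongrightarrow> 0 *\<^sub>R u"
    by (intro tendsto_intros LIMSEQ_power_zero) (use q in auto)
  then have "y \<le> 0 *\<^sub>R u"
    by (rule tendsto_le_eucl[OF tendsto_const _ bound])
  then show False using nonneg[OF y(1)] y(2) by simp
qed

theorem exists_eigenvector:
  assumes "x0 \<in> K" "x0 \<noteq> 0"
  obtains v \<alpha> where "v \<in> K" "v \<noteq> 0" "0 \<le> \<alpha>" "T v = \<alpha> *\<^sub>R v"
proof -
  obtain y where y: "y \<in> K" "y \<noteq> 0" "T y = 0 \<or> supp (T y) = supp y"
    using exists_zero_or_stable_supp[OF assms] .
  show thesis
  proof (cases "T y = 0")
    case True
    then show thesis using that[of y 0] y by simp
  next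
    case False
    then have S: "supp (T y) = supp y" using y by simp
    obtain c0 where c0: "c0 > 0" "y \<le> c0 *\<^sub>R T y"
      using supp_subset_imp_le_scaleR nonneg y T_mem S by (metis order_refl)
    define c where "c = 1 / c0"
    have "c *\<^sub>R y \<le> c *\<^sub>R c0 *\<^sub>R T y"
      using c0 by (intro scaleR_left_mono) (auto simp: c_def)
    then have c: "0 < c" "c *\<^sub>R y \<le> T y" using c0 by (simp_all add: c_def)
    obtain C where C: "C > 0" "T y \<le> C *\<^sub>R y"
      using supp_subset_imp_le_scaleR nonneg y T_mem S by (metis order_refl)
    define P where "P = {l. 0 < l \<and> (\<exists>u\<in>K. y \<le> u \<and> T u \<le> l *\<^sub>R u)}"
    have C_P: "C \<in> P" using C y by (auto simp: P_def)
    have c_le: "c \<le> l" if "l \<in> P" for l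
      using that lower_bound_subeigenvalue[OF y(1,2) c(2,1)] by (auto simp: P_def)
    then have bdd: "bdd_below P" by (rule bdd_belowI)
    define r where "r = Inf P"
    have "c \<le> r" unfolding r_def using C_P c_le by (intro cInf_greatest) auto
    then have r: "0 < r" using c by simp
    have r_le: "r \<le> l" if "l \<in> P" for l
      unfolding r_def using that bdd by (rule cInf_lower)
    have "\<exists>l\<in>P. l < r + 1 / real (Suc n)" for n
      using cInf_lessD[of P "r + 1 / real (Suc n)"] C_P by (auto simp: r_def)
    then obtain l where l: "\<And>n. l n \<in> P" "\<And>n. l n < r + 1 / real (Suc n)"
      by metis
    have "l \<longlonglongrightarrow> r"
    proof (rule tendsto_sandwich[of "\<lambda>n. r"])
      show "(\<lambda>n. r + 1 / real (Suc n)) \<longlonglongrightarrow> r"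
        using tendsto_add[OF tendsto_const LIMSEQ_inverse_real_of_nat, of r]
        by (simp add: divide_inverse)
    qed (use l r_le in \<open>auto intro!: always_eventually less_imp_le\<close>)
    moreover obtain u where "\<And>n. u n \<in> K" "\<And>n. y \<le> u n" "\<And>n. T (u n) \<le> l n *\<^sub>R u n"
      using l(1) unfolding P_def by simp metis
    moreover have "\<And>n. 0 < l n" using l(1) by (auto simp: P_def)
    ultimately obtain v t where v: "v \<in> K" "v \<noteq> 0" and t: "0 \<le> t" "t *\<^sub>R y \<le> v"
      and eq: "r *\<^sub>R v = sup ((r * t) *\<^sub>R y) (T v)"
      using exists_limit_resolvent[OF y(1,2), of u l] by metis
    show thesis
    proof (cases "t = 0")
      case True
      then have "r *\<^sub>R v = T v"
        using eq nonneg[OF T_mem[OF v(1)]] by (simp add: sup.absorb2)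
      then show thesis using that v r by (metis less_imp_le)
    next
      case False
      with t have t0: "0 < t" by simp
      \<comment> \<open>Above \<open>v\<close> every vector dominates \<open>t y\<close>; rescaled by \<open>1 / t\<close> it dominates \<open>y\<close> and witnesses \<open>\<mu> \<in> P\<close>.\<close>
      have "r \<le> \<mu>" if z: "z \<in> K" "v \<le> z" "0 < \<mu>" "T z \<le> \<mu> *\<^sub>R z" for z \<mu>
      proof -
        have "(1 / t) *\<^sub>R t *\<^sub>R y \<le> (1 / t) *\<^sub>R z"
          using t t0 z by (intro scaleR_left_mono order_trans[OF t(2) z(2)]) auto
        moreover have "(1 / t) *\<^sub>R T z \<le> (1 / t) *\<^sub>R \<mu> *\<^sub>R z"
          using t0 z by (intro scaleR_left_mono) auto
        ultimately have "\<mu> \<in> P"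
          using t0 z T_scale[of z "1 / t"] scale_mem[of z "1 / t"]
          unfolding P_def by (auto intro!: bexI[of _ "(1 / t) *\<^sub>R z"] simp: mult.commute)
        then show ?thesis by (rule r_le)
      qed
      moreover have "T v \<le> r *\<^sub>R v" using eq by simp
      ultimately obtain w where "w \<in> K" "w \<noteq> 0" "T w = r *\<^sub>R w"
        using eigenvector_of_critical_subeigenvector[OF v(1) r] by metis
      then show thesis using that r by (metis less_imp_le)
    qed
  qed
qed

end

section \<open>Matrices over the max-times semiring\<close>

lemma mult_Max_range_le_iff:
  fixes f :: "'n::finite \<Rightarrow> real"
  assumes "0 \<le> c"
  shows "c * Max (range f) \<le> d \<longleftrightarrow> (\<forall>k. c * f k \<le> d)"
proof
  assume le: "c * Max (range f) \<le> d"
  show "\<forall>k. c * f k \<le> d"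
  proof
    fix k
    have "c * f k \<le> c * Max (range f)"
      using assms by (intro mult_left_mono Max_ge) auto
    then show "c * f k \<le> d" using le by simp
  qed
next
  assume all: "\<forall>k. c * f k \<le> d"
  have "Max (range f) \<in> range f" by (rule Max_in) auto
  then obtain k where "Max (range f) = f k" by blast
  then show "c * Max (range f) \<le> d" using all by simp
qed

text \<open>
  An element of a partial order is determined by its upper bounds, and \<open>w\<close> bounds a max-product from
  above iff it bounds each single term. The algebraic laws below are obtained by comparing upper
  bounds, which avoids rearranging nested maxima.
\<close>

lemma max_matrix_vec_le_iff:
  "A \<otimes>\<^sub>v v \<le> w \<longleftrightarrow> (\<forall>i k. A $ i $ k * v $ k \<le> w $ i)"
  by (auto simp: less_eq_vec_def max_matrix_vec_def)

lemma eq_by_upper_bounds: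
  fixes x y :: "'a::order"
  assumes "\<And>w. x \<le> w \<longleftrightarrow> y \<le> w"
  shows "x = y"
  using assms by (meson order.antisym order_refl)

lemma max_matrix_vec_assoc:
  assumes "nonneg_mat A" "nonneg_vec v"
  shows "A \<otimes>\<^sub>v (B \<otimes>\<^sub>v v) = (A \<otimes>\<^sub>m B) \<otimes>\<^sub>v v"
proof (rule eq_by_upper_bounds)
  fix w
  have "A \<otimes>\<^sub>v (B \<otimes>\<^sub>v v) \<le> w \<longleftrightarrow>
      (\<forall>i k. A $ i $ k * Max (range (\<lambda>j. B $ k $ j * v $ j)) \<le> w $ i)"
    unfolding max_matrix_vec_le_iff by (simp add: max_matrix_vec_def)
  also have "\<dots> \<longleftrightarrow> (\<forall>i k j. A $ i $ k * (B $ k $ j * v $ j) \<le> w $ i)"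
    using assms(1) by (simp add: mult_Max_range_le_iff nonneg_mat_def)
  also have "\<dots> \<longleftrightarrow> (\<forall>i j k. v $ j * (A $ i $ k * B $ k $ j) \<le> w $ i)"
    by (auto simp: mult_ac)
  also have "\<dots> \<longleftrightarrow> (\<forall>i j. v $ j * Max (range (\<lambda>k. A $ i $ k * B $ k $ j)) \<le> w $ i)"
    using assms(2) by (simp add: mult_Max_range_le_iff nonneg_vec_def)
  also have "\<dots> \<longleftrightarrow> (A \<otimes>\<^sub>m B) \<otimes>\<^sub>v v \<le> w"
    by (simp add: max_matrix_vec_le_iff max_matrix_mult_def mult.commute)
  finally show "A \<otimes>\<^sub>v (B \<otimes>\<^sub>v v) \<le> w \<longleftrightarrow> (A \<otimes>\<^sub>m B) \<otimes>\<^sub>v v \<le> w" .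
qed

lemma max_matrix_vec_sup:
  assumes "nonneg_mat A"
  shows "A \<otimes>\<^sub>v sup x y = sup (A \<otimes>\<^sub>v x) (A \<otimes>\<^sub>v y)"
proof (rule eq_by_upper_bounds)
  fix w
  have "a * max b c = max (a * b) (a * c)" if "0 \<le> a" for a b c :: real
    using that by (simp add: max_mult_distrib_left)
  then have "A \<otimes>\<^sub>v sup x y \<le> w \<longleftrightarrow> A \<otimes>\<^sub>v x \<le> w \<and> A \<otimes>\<^sub>v y \<le> w"
    using assms unfolding max_matrix_vec_le_iff
    by (auto simp: sup_vec_def sup_real_def nonneg_mat_def)
  then show "A \<otimes>\<^sub>v sup x y \<le> w \<longleftrightarrow> sup (A \<otimes>\<^sub>v x) (A \<otimes>\<^sub>v y) \<le> w"
    by simp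
qed

lemma max_matrix_vec_scaleR:
  assumes "0 \<le> c"
  shows "A \<otimes>\<^sub>v (c *\<^sub>R x) = c *\<^sub>R (A \<otimes>\<^sub>v x)"
proof (rule eq_by_upper_bounds)
  fix w
  show "A \<otimes>\<^sub>v (c *\<^sub>R x) \<le> w \<longleftrightarrow> c *\<^sub>R (A \<otimes>\<^sub>v x) \<le> w"
    using assms
    by (simp add: max_matrix_vec_le_iff) (simp add: less_eq_vec_def max_matrix_vec_def mult_Max_range_le_iff mult_ac)
qed

lemma nonneg_max_matrix_vec:
  assumes "nonneg_mat A" "nonneg_vec v"
  shows "nonneg_vec (A \<otimes>\<^sub>v v)"
  using assms unfolding nonneg_vec_def nonneg_mat_def max_matrix_vec_def
  by (auto simp: Max_ge_iff)

lemma continuous_on_max_matrix_vec: "continuous_on S (\<lambda>v. A \<otimes>\<^sub>v v)"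
proof -
  have "continuous_on S (\<lambda>v. Max ((\<lambda>k. A $ i $ k * v $ k) ` F))" if "finite F" "F \<noteq> {}" for i F
    using that
  proof (induction F rule: finite_ne_induct)
    case (insert k F)
    then have "continuous_on S (\<lambda>v. max (A $ i $ k * v $ k) (Max ((\<lambda>k. A $ i $ k * v $ k) ` F)))"
      by (intro continuous_on_max continuous_on_mult_left continuous_on_component continuous_on_id insert.IH)
    then show ?case using insert by simp
  qed (simp add: continuous_on_mult_left continuous_on_component)
  then show ?thesis
    unfolding max_matrix_vec_def by (intro continuous_intros) auto
qed

lemma nonneg_vec_iff: "nonneg_vec v \<longleftrightarrow> 0 \<le> v"
  by (simp add: nonneg_vec_def less_eq_vec_def)

lemma max_matrix_exists_eigenvector_in_cone:
  assumes A: "nonneg_mat A" and K: "closed K" "\<And>v. v \<in> K \<Longrightarrow> nonneg_vec v"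
    "\<And>v c. v \<in> K \<Longrightarrow> 0 \<le> c \<Longrightarrow> c *\<^sub>R v \<in> K"
    "\<And>v w. v \<in> K \<Longrightarrow> w \<in> K \<Longrightarrow> sup v w \<in> K"
    "\<And>v. v \<in> K \<Longrightarrow> A \<otimes>\<^sub>v v \<in> K"
    and ne: "x \<in> K" "x \<noteq> 0"
  obtains v \<alpha> where "v \<in> K" "v \<noteq> 0" "0 \<le> \<alpha>" "A \<otimes>\<^sub>v v = \<alpha> *\<^sub>R v"
proof -
  interpret max_cone_map K "\<lambda>v. A \<otimes>\<^sub>v v"
    by unfold_locales
       (use K A in \<open>auto simp: nonneg_vec_iff max_matrix_vec_sup max_matrix_vec_scaleR
          continuous_on_max_matrix_vec\<close>)
  show thesis using exists_eigenvector[OF ne] that by blast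
qed

theorem corollary3p3:
  fixes A B :: "real ^ 'n ^ 'n"
  assumes "nonneg_mat A" and "nonneg_mat B"
    and "A \<otimes>\<^sub>m B = B \<otimes>\<^sub>m A"
  shows "\<exists>(v :: real ^ 'n) (\<alpha> :: real) (\<mu> :: real).
    nonneg_vec v \<and> v \<noteq> 0 \<and> 0 \<le> \<alpha> \<and> 0 \<le> \<mu> \<and>
    A \<otimes>\<^sub>v v = \<alpha> *\<^sub>R v \<and> B \<otimes>\<^sub>v v = \<mu> *\<^sub>R v"
proof -
  define N where "N = {v :: real ^ 'n. nonneg_vec v}"
  have closed_N: "closed N"
    unfolding N_def nonneg_vec_def by (intro closed_Collect_all closed_Collect_le continuous_intros)
  have scale_N: "c *\<^sub>R v \<in> N" if "v \<in> N" "0 \<le> c" for v c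
    using that by (simp add: N_def nonneg_vec_def)
  have sup_N: "sup v w \<in> N" if "v \<in> N" "w \<in> N" for v w
    using that by (auto simp: N_def nonneg_vec_def sup_vec_def sup_real_def le_max_iff_disj)
  have one: "(1 :: real ^ 'n) \<in> N" "(1 :: real ^ 'n) \<noteq> 0"
    by (simp_all add: N_def nonneg_vec_def vec_eq_iff)
  obtain a \<alpha> where a: "a \<in> N" "a \<noteq> 0" "0 \<le> \<alpha>" "A \<otimes>\<^sub>v a = \<alpha> *\<^sub>R a"
    by (rule max_matrix_exists_eigenvector_in_cone[OF assms(1) closed_N _ scale_N sup_N _ one])
       (use assms(1) nonneg_max_matrix_vec in \<open>auto simp: N_def\<close>)
  define K where "K = {v \<in> N. A \<otimes>\<^sub>v v = \<alpha> *\<^sub>R v}"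
  have closed_K: "closed K"
  proof -
    have "closed {v. A \<otimes>\<^sub>v v = \<alpha> *\<^sub>R v}"
      by (intro closed_Collect_eq continuous_on_max_matrix_vec continuous_intros)
    then show ?thesis using closed_N by (auto simp: K_def Collect_conj_eq)
  qed
  have scale_K: "c *\<^sub>R v \<in> K" if "v \<in> K" "0 \<le> c" for v c
    using that scale_N by (simp add: K_def max_matrix_vec_scaleR mult.commute)
  have sup_K: "sup v w \<in> K" if "v \<in> K" "w \<in> K" for v w
  proof -
    show ?thesis
      using that sup_N assms(1) a(3) by (simp add: K_def max_matrix_vec_sup scaleR_sup)
  qed
  have B_K: "B \<otimes>\<^sub>v v \<in> K" if "v \<in> K" for v
  proof -
    have v: "nonneg_vec v" "A \<otimes>\<^sub>v v = \<alpha> *\<^sub>R v" using that by (auto simp: K_def N_def)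
    have "A \<otimes>\<^sub>v (B \<otimes>\<^sub>v v) = B \<otimes>\<^sub>v (A \<otimes>\<^sub>v v)"
      by (simp only: max_matrix_vec_assoc[OF assms(1) v(1)] max_matrix_vec_assoc[OF assms(2) v(1)] assms(3))
    then show ?thesis
      using v a(3) assms(2) by (simp add: K_def N_def nonneg_max_matrix_vec max_matrix_vec_scaleR)
  qed
  have a_K: "a \<in> K" using a by (simp add: K_def)
  obtain v \<mu> where "v \<in> K" "v \<noteq> 0" "0 \<le> \<mu>" "B \<otimes>\<^sub>v v = \<mu> *\<^sub>R v"
    by (rule max_matrix_exists_eigenvector_in_cone[OF assms(2) closed_K _ scale_K sup_K B_K a_K a(2)])
       (auto simp: K_def N_def)
  then show ?thesis using a(3) by (auto simp: K_def N_def)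
qed

end
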